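(* There exists a constant $\delta > 0$ such that for every sufficiently large integer $n$ there exists a triangle-free $n$-vertex graph $G$ such that $\xi(\overline{G},\mathbb{F}_2) \leq n^{1-\delta}$.
   Context: $\overline{G}$ denotes the complement of $G$ and $\mathbb{F}_2$ the binary field. For a graph $H=(V,E)$ and a field $\mathbb{F}$, a $t$-dimensional orthogonal representation of $H$ over $\mathbb{F}$ is an assignment of a vector $u_v \in \mathbb{F}^t$ with $\langle u_v,u_v\rangle \neq 0$ to every vertex $v$, such that $\langle u_v,u_{v'}\rangle = 0$ whenever $v,v'$ are adjacent in $H$; $\xi(H,\mathbb{F})$ is the smallest such $t$. Here $\langle x,y\rangle=\sum_i x_iy_i$. *)

theory Defs
  imports
    Complex_Main
    "HOL-Library.Z2"
    "Graph_Theory.Pair_Digraph"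
    "Jordan_Normal_Form.Matrix"
begin

text \<open>
  Finite simple graphs are the instances of the locale \<^locale>\<open>pair_graph\<close> (finite, symmetric,
  loop-free); an edge \<open>{x, y}\<close> is the pair of arcs \<open>(x, y)\<close> and \<open>(y, x)\<close>. The binary field is
  the type \<^typ>\<open>bit\<close>.
\<close>

definition graph_complement :: "'a pair_pre_digraph \<Rightarrow> 'a pair_pre_digraph" where
  "graph_complement G =
     \<lparr>pverts = pverts G,
      parcs = {(x, y). x \<in> pverts G \<and> y \<in> pverts G \<and> x \<noteq> y \<and> (x, y) \<notin> parcs G}\<rparr>"

text \<open>In a simple graph, pairwise adjacent vertices are automatically distinct.\<close>

definition triangle_free :: "'a pair_pre_digraph \<Rightarrow> bool" where
  "triangle_free G \<longleftrightarrow>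
     \<not> (\<exists>x y z. (x, y) \<in> parcs G \<and> (y, z) \<in> parcs G \<and> (x, z) \<in> parcs G)"

definition orthogonal_representation ::
    "'a pair_pre_digraph \<Rightarrow> nat \<Rightarrow> ('a \<Rightarrow> 'f::field vec) \<Rightarrow> bool" where
  "orthogonal_representation H t u \<longleftrightarrow>
     (\<forall>v\<in>pverts H. u v \<in> carrier_vec t \<and> u v \<bullet> u v \<noteq> 0) \<and>
     (\<forall>v\<in>pverts H. \<forall>w\<in>pverts H. (v, w) \<in> parcs H \<longrightarrow> u v \<bullet> u w = 0)"

definition xi :: "'a pair_pre_digraph \<Rightarrow> 'f::field itself \<Rightarrow> nat" where
  "xi H F = (LEAST t. \<exists>u :: 'a \<Rightarrow> 'f vec. orthogonal_representation H t u)"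

lemma pair_graph_graph_complement:
  assumes "pair_graph G"
  shows "pair_graph (graph_complement G)"
proof -
  interpret pair_graph G by fact
  have "parcs (graph_complement G) \<subseteq> pverts G \<times> pverts G"
    by (auto simp: graph_complement_def)
  then have "finite (parcs (graph_complement G))"
    using pair_finite_verts by (meson finite_SigmaI finite_subset)
  moreover have "sym (parcs (graph_complement G))"
    by (auto simp: graph_complement_def sym_def dest: arcs_symmetric)
  ultimately show ?thesis
    using pair_finite_verts
    by unfold_locales (auto simp: graph_complement_def symmetric_def)
qed

text \<open>The minimum defining \<^const>\<open>xi\<close> is attained: distinct unit vectors are a representation.\<close>

lemma orthogonal_representation_xi:
  assumes "pair_graph H"
  shows "\<exists>u :: 'a \<Rightarrow> 'f::field vec. orthogonal_representation H (xi H TYPE('f)) u"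
proof -
  interpret pair_graph H by fact
  obtain h where h: "bij_betw h (pverts H) {0..<card (pverts H)}"
    using ex_bij_betw_finite_nat[OF pair_finite_verts] by blast
  have lt: "h v < card (pverts H)" if "v \<in> pverts H" for v
    using h that by (auto simp: bij_betw_def)
  have neq: "h v \<noteq> h w" if "(v, w) \<in> parcs H" for v w
    using h no_loops'[OF that] wellformed'[OF that]
    by (auto simp: bij_betw_def inj_on_def)
  have "orthogonal_representation H (card (pverts H))
          (\<lambda>v. unit_vec (card (pverts H)) (h v) :: 'f vec)"
    using lt by (auto simp: orthogonal_representation_def dest: neq)
  then show ?thesis
    unfolding xi_def
    by (intro LeastI_ex[where P = "\<lambda>t. \<exists>u :: 'a \<Rightarrow> 'f vec. orthogonal_representation H t u"])
       blast
qed

end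

theory Submission
  imports Defs "HOL-Real_Asymp.Real_Asymp"
begin

text \<open>
  Take as vertices \<open>s\<close>-subsets of a \<open>3q\<close>-element set with \<open>s\<close> about \<open>3q/2\<close>, and join \<open>A\<close> and
  \<open>B\<close> when \<open>\<bar>A \<inter> B\<bar> < m\<close> for \<open>m = s - q\<close>. Three pairwise adjacent sets would need
  more than \<open>3q\<close> points in their union, so the graph is triangle-free. Over \<open>\<int>\<close>, the binomial
  \<open>(k - m) choose q\<close> is a combination of the binomials \<open>k choose j\<close> with \<open>j \<le> q\<close>; it vanishes
  for \<open>m \<le> k < s\<close> and is \<open>1\<close> at \<open>k = s\<close>. Sending \<open>A\<close> to the indicator vector of those
  \<open>J \<subseteq> A\<close> with \<open>\<bar>J\<bar> \<le> q\<close> for which the coefficient of \<open>k choose \<bar>J\<bar>\<close> is odd realizes this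
  polynomial modulo 2, at \<open>k = \<bar>A \<inter> B\<bar>\<close>, as an inner product. The dimension is at most the number
  of subsets of size at most \<open>q\<close>, hence at most \<open>(27/4)\<^sup>q\<close>, while for large \<open>q\<close> there are at least \<open>7\<^sup>q\<close> vertices.
\<close>

text \<open>Pascal's rule gives \<open>(k - Suc m) choose Suc q\<close> as
  \<open>(k - m) choose Suc q\<close> minus \<open>(k - Suc m) choose q\<close>. Hence the induction
  on \<open>m\<close> for all \<open>q\<close>, with an inner induction on \<open>q\<close>. Only
  ring operations occur, with no division by factorials, so the expansion is available in
  characteristic 2.\<close>

lemma shifted_binomial_expansion:
  "\<exists>c :: nat \<Rightarrow> 'a::comm_ring_1. \<forall>k\<ge>m.
     (\<Sum>j\<le>q. c j * of_nat (k choose j)) = of_nat ((k - m) choose q)"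
proof (induction m arbitrary: q)
  case 0
  have "(\<Sum>j\<le>q. (if j = q then 1 else 0 :: 'a) * of_nat (k choose j)) = of_nat (k choose q)" for k
    by (simp add: if_distrib[of "\<lambda>x. x * _"] cong: if_cong)
  then show ?case
    by (intro exI[of _ "\<lambda>j. if j = q then 1 else 0"]) simp
next
  case (Suc m)
  note outer = Suc.IH
  show ?case
  proof (induction q)
    case 0
    show ?case by (intro exI[of _ "\<lambda>_. 1"]) simp
  next
    case (Suc q)
    obtain c1 :: "nat \<Rightarrow> 'a" where
      c1: "\<And>k. m \<le> k \<Longrightarrow> (\<Sum>j\<le>Suc q. c1 j * of_nat (k choose j)) = of_nat ((k - m) choose Suc q)"
      using outer[of "Suc q"] by blast
    obtain c2 :: "nat \<Rightarrow> 'a" where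
      c2: "\<And>k. Suc m \<le> k \<Longrightarrow> (\<Sum>j\<le>q. c2 j * of_nat (k choose j)) = of_nat ((k - Suc m) choose q)"
      using Suc.IH by blast
    \<comment> \<open>The subtracted expansion stops at \<open>q\<close>, so the top index
      \<open>Suc q\<close> keeps \<open>c1\<close> alone.\<close>
    define c where "c j = (if j \<le> q then c1 j - c2 j else c1 j)" for j
    have "(\<Sum>j\<le>Suc q. c j * of_nat (k choose j)) = of_nat ((k - Suc m) choose Suc q)"
      if k: "Suc m \<le> k" for k
    proof -
      have "(\<Sum>j\<le>Suc q. c j * of_nat (k choose j)) =
          (\<Sum>j\<le>Suc q. c1 j * of_nat (k choose j)) - (\<Sum>j\<le>q. c2 j * of_nat (k choose j))"
        by (simp add: c_def algebra_simps sum_subtractf)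
      also have "\<dots> = of_nat ((k - m) choose Suc q) - of_nat ((k - Suc m) choose q)"
        using k by (simp only: c1 c2 Suc_leD)
      also have "k - m = Suc (k - Suc m)"
        using k by simp
      finally show ?thesis by simp
    qed
    then show ?case by blast
  qed
qed

text \<open>Inclusion-exclusion truncated after the pairwise terms; it is what rules out
  triangles.\<close>

lemma card_three_sets_le:
  assumes "finite U" "A \<subseteq> U" "B \<subseteq> U" "C \<subseteq> U"
  shows "card A + card B + card C \<le> card U + card (A \<inter> B) + card (A \<inter> C) + card (B \<inter> C)"
proof -
  have fin: "finite A" "finite B" "finite C"
    using assms by (auto intro: finite_subset)
  have "card A + card B = card (A \<union> B) + card (A \<inter> B)"
    using fin card_Un_Int by blast
  moreover have "card (A \<union> B) + card C = card (A \<union> B \<union> C) + card ((A \<union> B) \<inter> C)"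
    using fin by (intro card_Un_Int) auto
  moreover have "card ((A \<union> B) \<inter> C) \<le> card (A \<inter> C) + card (B \<inter> C)"
    unfolding Int_Un_distrib2 by (rule card_Un_le)
  moreover have "card (A \<union> B \<union> C) \<le> card U"
    using assms by (intro card_mono) auto
  ultimately show ?thesis by linarith
qed

lemma sum_coeff_subsets:
  fixes c :: "nat \<Rightarrow> 'a::comm_ring_1"
  assumes "finite X"
  shows "(\<Sum>J\<in>{J. J \<subseteq> X \<and> card J \<le> q}. c (card J)) = (\<Sum>j\<le>q. c j * of_nat (card X choose j))"
proof -
  have fin: "finite {J. J \<subseteq> X \<and> card J \<le> q}"
    using assms by auto
  have "(\<Sum>J\<in>{J. J \<subseteq> X \<and> card J \<le> q}. c (card J)) =
      (\<Sum>j\<le>q. \<Sum>J\<in>{J \<in> {J. J \<subseteq> X \<and> card J \<le> q}. card J = j}. c (card J))"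
    using fin by (intro sum.group[symmetric]) auto
  also have "\<dots> = (\<Sum>j\<le>q. \<Sum>J\<in>{J. J \<subseteq> X \<and> card J = j}. c j)"
    by (intro sum.cong) auto
  also have "\<dots> = (\<Sum>j\<le>q. c j * of_nat (card X choose j))"
    using assms by (simp add: n_subsets mult.commute)
  finally show ?thesis .
qed

text \<open>Each term with \<open>j \<le> q\<close> is weighted by
  \<open>2 ^ q * (1 / 2) ^ j\<close>, which is at least 1. Extending the sum to all
  \<open>j \<le> 3 * q\<close> then yields the binomial expansion of
  \<open>2 ^ q * (3 / 2) ^ (3 * q)\<close>.\<close>

lemma card_small_subsets_le:
  "real (card {J. J \<subseteq> {..<3 * q} \<and> card J \<le> q}) \<le> (27 / 4) ^ q"
proof -
  have "real (card {J. J \<subseteq> {..<3 * q} \<and> card J \<le> q}) = (\<Sum>j\<le>q. real (3 * q choose j))"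
    using sum_coeff_subsets[of "{..<3 * q}" "\<lambda>_. 1::real" q] by simp
  also have "\<dots> \<le> (\<Sum>j\<le>q. 2 ^ q * (real (3 * q choose j) * (1 / 2) ^ j))"
  proof (intro sum_mono)
    fix j assume "j \<in> {..q}"
    then have "(2::real) ^ j \<le> 2 ^ q"
      by simp
    then have "1 \<le> 2 ^ q * (1 / 2 :: real) ^ j"
      by (simp add: power_one_over field_simps)
    then have "real (3 * q choose j) * 1 \<le> real (3 * q choose j) * (2 ^ q * (1 / 2) ^ j)"
      by (intro mult_left_mono) simp_all
    then show "real (3 * q choose j) \<le> 2 ^ q * (real (3 * q choose j) * (1 / 2) ^ j)"
      by (simp add: mult_ac)
  qed
  also have "\<dots> \<le> (\<Sum>j\<le>3 * q. 2 ^ q * (real (3 * q choose j) * (1 / 2) ^ j))"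
    by (intro sum_mono2) auto
  also have "\<dots> = 2 ^ q * (1 + 1 / 2) ^ (3 * q)"
    by (subst add.commute, subst binomial_ring) (simp add: sum_distrib_left)
  also have "\<dots> = (2 * (3 / 2) ^ 3) ^ q"
    by (simp add: power_mult power_mult_distrib)
  finally show ?thesis
    by (simp add: power3_eq_cube)
qed

lemma power2_le_central_binomial: "2 ^ n \<le> (n + 1) * (n choose (n div 2))"
proof -
  have "(2::nat) ^ n = (\<Sum>k\<le>n. n choose k)"
    by (simp add: choose_row_sum)
  also have "\<dots> \<le> (\<Sum>k\<le>n. n choose (n div 2))"
    by (intro sum_mono binomial_maximum)
  finally show ?thesis by simp
qed

lemma xi_le:
  fixes u :: "'a \<Rightarrow> 'f::field vec"
  assumes "orthogonal_representation H t u"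
  shows "xi H TYPE('f) \<le> t"
  unfolding xi_def using assms by (intro Least_le) blast

text \<open>Any \<open>n\<close> of the \<open>s\<close>-subsets may serve as vertices:
  triangle-freeness and the representation both survive passing to an induced subgraph. This is what
  later reaches every large \<open>n\<close>.\<close>

lemma triangle_free_small_binary_xi:
  assumes n: "n \<le> 3 * q choose (3 * q div 2)"
  shows "\<exists>G :: nat pair_pre_digraph. pair_graph G \<and> card (pverts G) = n \<and> triangle_free G \<and>
    real (xi (graph_complement G) TYPE(bit)) \<le> (27 / 4) ^ q"
proof -
  define s where "s = 3 * q div 2"
  \<comment> \<open>No truncation occurs, as \<open>3 * q div 2\<close> is at least
    \<open>q\<close>.\<close>
  define m where "m = s - q"
  have s: "s = m + q"
    by (simp add: s_def m_def)
  define \<A> where "\<A> = {A. A \<subseteq> {..<3 * q} \<and> card A = s}"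
  have "finite \<A>"
    by (simp add: \<A>_def)
  moreover have "card {..<n} \<le> card \<A>"
    using n by (simp add: \<A>_def n_subsets s_def)
  ultimately obtain g where g: "g ` {..<n} \<subseteq> \<A>" "inj_on g {..<n}"
    using card_le_inj[of "{..<n}" \<A>] by blast
  have gsub: "g i \<subseteq> {..<3 * q}" and gcard: "card (g i) = s" if "i < n" for i
    using g that by (auto simp: \<A>_def)
  have gfin: "finite (g i)" if "i < n" for i
    using gsub[OF that] finite_subset by blast
  define E where "E = {(i, j). i < n \<and> j < n \<and> i \<noteq> j \<and> card (g i \<inter> g j) < m}"
  define G where "G = \<lparr>pverts = {..<n}, parcs = E\<rparr>"
  have "finite E"
    by (rule finite_subset[of _ "{..<n} \<times> {..<n}"]) (auto simp: E_def)
  then have graph: "pair_graph G"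
    by unfold_locales (auto simp: G_def E_def symmetric_def sym_def Int_commute)
  have tri: "triangle_free G"
  proof -
    \<comment> \<open>A triangle would give \<open>3 * s < 3 * q + 3 * m\<close>, whereas
      \<open>s = m + q\<close> makes the two sides equal.\<close>
    have False if "(x, y) \<in> E" "(y, z) \<in> E" "(x, z) \<in> E" for x y z
      using that card_three_sets_le[of "{..<3 * q}" "g x" "g y" "g z"]
        gsub[of x] gsub[of y] gsub[of z] gcard[of x] gcard[of y] gcard[of z]
      by (auto simp: E_def s)
    then show ?thesis
      by (auto simp: triangle_free_def G_def)
  qed
  obtain c :: "nat \<Rightarrow> bit" where
    c: "\<And>k. m \<le> k \<Longrightarrow> (\<Sum>j\<le>q. c j * of_nat (k choose j)) = of_nat ((k - m) choose q)"
    using shifted_binomial_expansion by blast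
  define \<J> where "\<J> = {J. J \<subseteq> {..<3 * q} \<and> card J \<le> q}"
  have finJ: "finite \<J>"
    by (simp add: \<J>_def)
  define t where "t = card \<J>"
  obtain h where h: "bij_betw h {0..<t} \<J>"
    using ex_bij_betw_nat_finite[OF finJ] by (auto simp: t_def)
  define u where "u i = vec t (\<lambda>a. c (card (h a)) * of_bool (h a \<subseteq> g i))" for i
  have inner: "u i \<bullet> u j = of_nat ((card (g i \<inter> g j) - m) choose q)"
    if ij: "i < n" "j < n" "m \<le> card (g i \<inter> g j)" for i j
  proof -
    have "u i \<bullet> u j =
        (\<Sum>a\<in>{0..<t}. (\<lambda>J. c (card J) * of_bool (J \<subseteq> g i \<inter> g j)) (h a))"
      unfolding scalar_prod_def
    proof (rule sum.cong)
      fix a assume "a \<in> {0..<t}"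
      \<comment> \<open>Elements of the binary field are idempotent, so the squared coefficient is
        the coefficient itself.\<close>
      then show "u i $ a * u j $ a = c (card (h a)) * of_bool (h a \<subseteq> g i \<inter> g j)"
        by (cases "h a \<subseteq> g i"; cases "h a \<subseteq> g j") (simp_all add: u_def)
    qed (simp add: u_def)
    also have "\<dots> = (\<Sum>J\<in>\<J>. c (card J) * of_bool (J \<subseteq> g i \<inter> g j))"
      by (rule sum.reindex_bij_betw[OF h])
    also have "\<dots> = (\<Sum>J\<in>{J. J \<subseteq> g i \<inter> g j \<and> card J \<le> q}. c (card J))"
      using gsub[OF ij(1)] finJ by (intro sum.mono_neutral_cong_right) (auto simp: \<J>_def)
    also have "\<dots> = (\<Sum>k\<le>q. c k * of_nat (card (g i \<inter> g j) choose k))"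
      using gfin[OF ij(1)] by (intro sum_coeff_subsets) auto
    also have "\<dots> = of_nat ((card (g i \<inter> g j) - m) choose q)"
      by (rule c[OF ij(3)])
    finally show ?thesis .
  qed
  have "orthogonal_representation (graph_complement G) t u"
    unfolding orthogonal_representation_def
  proof (intro conjI ballI impI)
    fix v assume "v \<in> pverts (graph_complement G)"
    then have v: "v < n"
      by (simp add: graph_complement_def G_def)
    show "u v \<in> carrier_vec t"
      by (simp add: u_def)
    show "u v \<bullet> u v \<noteq> 0"
      using inner[OF v v] gcard[OF v] by (simp add: s)
  next
    fix v w assume "(v, w) \<in> parcs (graph_complement G)"
    then have vw: "v < n" "w < n" "v \<noteq> w" "m \<le> card (g v \<inter> g w)"
      by (auto simp: graph_complement_def G_def E_def)
    have "g v \<noteq> g w"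
      using g(2) vw by (auto simp: inj_on_def)
    \<comment> \<open>Distinct sets of equal size do not contain each other, so the intersection has
      fewer than \<open>s\<close> points and the binomial vanishes.\<close>
    then have "g v \<inter> g w \<subset> g v"
      using card_subset_eq[OF gfin[OF vw(2)], of "g v"] gcard vw by auto
    then have "card (g v \<inter> g w) < s"
      using psubset_card_mono[OF gfin[OF vw(1)]] gcard[OF vw(1)] by metis
    then have "card (g v \<inter> g w) - m < q"
      using vw(4) s by linarith
    then show "u v \<bullet> u w = 0"
      using inner[OF vw(1,2,4)] by (simp add: binomial_eq_0)
  qed
  then have "real (xi (graph_complement G) TYPE(bit)) \<le> real t"
    using xi_le by force
  also have "\<dots> \<le> (27 / 4) ^ q"
    using card_small_subsets_le by (simp add: t_def \<J>_def)
  finally show ?thesis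
    using graph tri by (intro exI[of _ G]) (simp add: G_def)
qed

theorem theorem1p11:
  shows "\<exists>\<delta>::real. \<delta> > 0 \<and>
    (\<exists>n0::nat. \<forall>n\<ge>n0. \<exists>G :: nat pair_pre_digraph.
       pair_graph G \<and> card (pverts G) = n \<and> triangle_free G \<and>
       real (xi (graph_complement G) TYPE(bit)) \<le> real n powr (1 - \<delta>))"
proof -
  \<comment> \<open>Chosen so that \<open>7 powr (1 - \<delta>) = 69 / 10\<close>. This value lies
    strictly between \<open>27 / 4\<close> and \<open>7\<close>: being below 7 makes
    \<open>\<delta>\<close> positive, and the gap above \<open>27 / 4\<close> absorbs a constant
    factor.\<close>
  define \<delta> :: real where "\<delta> = 1 - log 7 (69 / 10)"
  have \<delta>: "\<delta> > 0" "1 - \<delta> > 0"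
    by (simp_all add: \<delta>_def)
  \<comment> \<open>With \<open>r = q + 1\<close>, the right side is
    \<open>2 ^ (3 * r) / (3 * r + 1)\<close>, a lower bound for the central binomial of
    \<open>3 * r\<close>.\<close>
  have "eventually (\<lambda>q. 7 ^ (q + 1) \<le> 8 ^ (q + 1) / (3 * real (q + 1) + 1)) sequentially"
    by real_asymp
  moreover have "eventually (\<lambda>q. (27 / 4 :: real) ^ (q + 1) \<le> (69 / 10) ^ q) sequentially"
    by real_asymp
  ultimately have "eventually (\<lambda>q. 7 ^ (q + 1) \<le> 8 ^ (q + 1) / (3 * real (q + 1) + 1) \<and>
      (27 / 4 :: real) ^ (q + 1) \<le> (69 / 10) ^ q) sequentially"
    by (rule eventually_conj)
  then obtain Q where
    Q: "\<And>q. q \<ge> Q \<Longrightarrow> 7 ^ (q + 1) \<le> 8 ^ (q + 1) / (3 * real (q + 1) + 1)"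
      "\<And>q. q \<ge> Q \<Longrightarrow> (27 / 4 :: real) ^ (q + 1) \<le> (69 / 10) ^ q"
    unfolding eventually_sequentially by blast
  have "\<exists>G :: nat pair_pre_digraph. pair_graph G \<and> card (pverts G) = n \<and> triangle_free G \<and>
       real (xi (graph_complement G) TYPE(bit)) \<le> real n powr (1 - \<delta>)" if n: "n \<ge> 7 ^ Q" for n
  proof -
    have "1 \<le> n"
      using n one_le_power[of "7::nat" Q] by linarith
    then obtain q where q: "7 ^ q \<le> n" "n < 7 ^ (q + 1)"
      using ex_power_ivl1[of 7 n] by auto
    have "(7::nat) ^ Q < 7 ^ (q + 1)"
      using n q(2) by linarith
    then have "Q < q + 1"
      by (rule power_less_imp_less_exp[rotated]) simp
    then have "Q \<le> q"
      by simp
    \<comment> \<open>The ground set is built from \<open>q + 1\<close> so that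
      \<open>n < 7 ^ r\<close> vertices fit, while the target bound rests on
      \<open>7 ^ q \<le> n\<close>; the cost is one extra factor \<open>27 / 4\<close>.\<close>
    define r where "r = q + 1"
    have "(3 * real r + 1) * 7 ^ r \<le> 8 ^ r"
      using Q(1)[OF \<open>Q \<le> q\<close>] by (simp add: r_def field_simps)
    also have "\<dots> = 2 ^ (3 * r)"
      by (simp add: power_mult)
    also have "\<dots> \<le> (3 * real r + 1) * real (3 * r choose (3 * r div 2))"
      using of_nat_mono[OF power2_le_central_binomial[of "3 * r"], where 'a = real]
      by (simp add: distrib_right)
    finally have "7 ^ r \<le> real (3 * r choose (3 * r div 2))"
      by (subst (asm) mult_le_cancel_left_pos) auto
    moreover have "real n \<le> real (7 ^ r)"
      unfolding of_nat_le_iff using q(2) by (simp add: r_def)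
    ultimately have "real n \<le> real (3 * r choose (3 * r div 2))"
      by simp
    then have "n \<le> 3 * r choose (3 * r div 2)"
      unfolding of_nat_le_iff .
    then obtain G :: "nat pair_pre_digraph" where
      G: "pair_graph G" "card (pverts G) = n" "triangle_free G"
        "real (xi (graph_complement G) TYPE(bit)) \<le> (27 / 4) ^ r"
      using triangle_free_small_binary_xi by blast
    note G(4)
    also have "(27 / 4 :: real) ^ r \<le> (69 / 10) ^ q"
      using Q(2)[OF \<open>Q \<le> q\<close>] by (simp add: r_def)
    also have "\<dots> = (7 powr (1 - \<delta>)) ^ q"
      by (simp add: \<delta>_def)
    also have "\<dots> = (7 ^ q) powr (1 - \<delta>)"
      by (simp add: powr_power powr_powr mult.commute flip: powr_realpow)
    also have "\<dots> \<le> real n powr (1 - \<delta>)"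
      using of_nat_mono[OF q(1), where 'a = real] \<delta>(2) by (intro powr_mono2) simp_all
    finally show ?thesis
      using G by blast
  qed
  then show ?thesis
    using \<delta>(1) by blast
qed

end
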